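(* Let $\mathcal F=(\Sigma,\sharp)$ be a ranked alphabet, $V=\mathbb K^d$ with $d\ge1$, and let $r=\langle V,\mu,\lambda\rangle$ be a recognizable tree series on $T(\mathcal F)$. For any tree $t$ over $\mathcal F$, let $G^t$ be its associated hypergraph over the ranked alphabet $(\Sigma\cup\{\lambda\},\sharp')$, as defined in the context. Consider the HWM $M=\langle V,\{T^x\}_{x\in\Sigma\cup\{\lambda\}},\odot_{id},\mathbf 1\rangle$ where $T^\lambda$ is the vector $\lambda\in V$ and, for every $k\geq 0$ and every $f\in\Sigma$ with $\sharp f=k$, $T^f$ is defined by $$T^f_{i_0i_1\dots i_k}=\mathbf e_{i_0}^\top\,\mu(f)(\mathbf e_{i_1},\dots,\mathbf e_{i_k}).$$ Then $r(t)=r_M(G^t)$ for every tree $t$ over $\mathcal F$.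
   Context: Throughout, $\mathbb K=\mathbb R$ or $\mathbb C$, $[d]=\{1,\dots,d\}$, and $(\mathbf e_1,\dots,\mathbf e_d)$ is the canonical basis of $\mathbb K^d$. A ranked alphabet $(\Sigma,\sharp)$ is a finite set $\Sigma$ with an arity map $\sharp:\Sigma\to\mathbb N$; it is positive if $\sharp x\ge 1$ for all $x\in\Sigma$. $T(\mathcal F)$ is the set of trees (terms) over $\mathcal F$: a tree $t$ is a map from a finite non-empty prefix-closed set $Pos(t)$ of finite words over the positive integers to $\Sigma$ such that for all $p\in Pos(t)$ with $\sharp t(p)=n$ one has $\{j: p\cdot j\in Pos(t)\}=\{1,\dots,n\}$ (empty if $n=0$). The root is the empty word $\varepsilon$. Recognizable tree series: $r=\langle V,\mu,\lambda\rangle$ where $\lambda\in V$ and $\mu$ maps each $f\in\Sigma$ of arity $p$ to a $p$-multilinear map $\mu(f):V^p\to V$ (an element of $V$ if $p=0$), with $r(t)=\lambda^\top\mu(t)$, where $\mu(f(t_1,\dots,t_p))=\mu(f)(\mu(t_1),\dots,\mu(t_p))$ inductively. A hypergraph $G=(V,E,l)$ over a positive ranked alphabet $(\Sigma,\sharp)$ consists of a non-empty finite set $V$ (vertices), a map $l:V\to\Sigma$, and a partition $E$ (whose non-empty blocks are called hyperedges) of the set of ports $P_G=\{(v,j): v\in V, 1\le j\le \sharp v\}$, where $\sharp v=\sharp l(v)$. Hypergraph of a tree: $G^t$ is the hypergraph over $(\Sigma\cup\{\lambda\},\sharp')$, where $\lambda$ (also) denotes a new symbol, $\sharp'(\lambda)=1$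 and $\sharp'(f)=\sharp f+1$ for $f\in\Sigma$, with vertex set $Pos(t)\cup\{0\}$ ($0$ a new vertex), labels $l(0)=\lambda$, $l(p)=t(p)$ for $p\in Pos(t)$, and hyperedges $\{(0,1),(\varepsilon,1)\}$ together with $\{(p,j+1),(p\cdot j,1)\}$ for every $p\cdot j\in Pos(t)$ (with $p\in Pos(t)$, $j\geq1$). A product on $\mathbb K^d$ is a bilinear map $\odot:\mathbb K^d\times\mathbb K^d\to\mathbb K^d$ that is associative and symmetric; the identity product $\odot_{id}$ is given by $\mathbf e_i\odot_{id}\mathbf e_j=\delta_{ij}\mathbf e_i$. Write $\mathbf 1=(1,\dots,1)^\top$. A rank $d$ Hypergraph Weighted Model (HWM) over a positive ranked alphabet $(\Sigma,\sharp)$ is a tuple $M=\langle \mathbb K^d,\{T^x\}_{x\in\Sigma},\odot,\alpha\rangle$ where $\odot$ is a product on $\mathbb K^d$, $\alpha\in\mathbb K^d$, and $T^x\in\bigotimes^{\sharp x}\mathbb K^d$ (viewed as an array $(T^x_{i_1\dots i_{\sharp x}})$) for each $x$. It computes the series $$r_M(G)=\sum_{\gamma:P_G\to[d]}\ \Big(\prod_{v\in V}T^{l(v)}_{\gamma(v,1)\dots\gamma(v,\sharp v)}\Big)\prod_{h\in E}\alpha^\top\Big(\bigodot_{p\in h}\mathbf e_{\gamma(p)}\Big)$$ (one factor for each port of $h$). *)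

theory Defs
  imports "HOL-Analysis.Analysis"
begin

(* The scalars are 'k :: real_normed_field. Since the norm of that class is multiplicative, its
   instances are, up to isometric isomorphism, exactly real and complex (Gelfand-Mazur).
   The space K^d is 'k ^ 'd, with [d] rendered by the finite index type 'd (d = CARD('d) >= 1);
   linearity is always linearity over 'k, i.e. with respect to *s. *)

section \<open>Ranked alphabets and trees\<close>

definition ranked_alphabet :: "'a set \<Rightarrow> ('a \<Rightarrow> nat) \<Rightarrow> bool" where
  "ranked_alphabet \<Sigma> ar \<longleftrightarrow> finite \<Sigma>"

definition positive_alphabet :: "'a set \<Rightarrow> ('a \<Rightarrow> nat) \<Rightarrow> bool" where
  "positive_alphabet \<Sigma> ar \<longleftrightarrow> ranked_alphabet \<Sigma> ar \<and> (\<forall>x\<in>\<Sigma>. 1 \<le> ar x)"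

(* A tree is a map on a set of positions; positions are words over the positive integers,
   Pos(t) is dom t, and t(p) is the (t p). *)

type_synonym 'a tree = "nat list \<Rightarrow> 'a option"

definition tree_over :: "'a set \<Rightarrow> ('a \<Rightarrow> nat) \<Rightarrow> 'a tree \<Rightarrow> bool" where
  "tree_over \<Sigma> ar t \<longleftrightarrow>
     finite (dom t) \<and> dom t \<noteq> {} \<and>
     (\<forall>p\<in>dom t. \<forall>j\<in>set p. 1 \<le> j) \<and>
     (\<forall>p q. p @ q \<in> dom t \<longrightarrow> p \<in> dom t) \<and>
     ran t \<subseteq> \<Sigma> \<and>
     (\<forall>p\<in>dom t. {j. p @ [j] \<in> dom t} = {1..ar (the (t p))})"

definition subtree :: "'a tree \<Rightarrow> nat \<Rightarrow> 'a tree" where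
  "subtree t j = (\<lambda>p. t (j # p))"

lemma card_dom_subtree:
  assumes "finite (dom t)" "t [] \<noteq> None"
  shows "card (dom (subtree t j)) < card (dom t)"
proof -
  have "(#) j ` dom (subtree t j) \<subset> dom t"
    using assms(2) by (auto simp: subtree_def dom_def)
  then have "card ((#) j ` dom (subtree t j)) < card (dom t)"
    using assms(1) by (simp add: psubset_card_mono)
  then show ?thesis by (simp add: card_image)
qed

section \<open>Recognizable tree series\<close>

(* The map mu f is applied to lists of length ar f only. *)

definition multilinear :: "nat \<Rightarrow> (('k::field ^ 'd) list \<Rightarrow> 'k ^ 'd) \<Rightarrow> bool" where
  "multilinear n m \<longleftrightarrow>
     (\<forall>vs i. length vs = n \<longrightarrow> i < n \<longrightarrow> Vector_Spaces.linear (*s) (*s) (\<lambda>v. m (vs[i := v])))"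

definition tree_representation ::
    "'a set \<Rightarrow> ('a \<Rightarrow> nat) \<Rightarrow> ('a \<Rightarrow> ('k::field ^ 'd) list \<Rightarrow> 'k ^ 'd) \<Rightarrow> bool" where
  "tree_representation \<Sigma> ar mu \<longleftrightarrow> (\<forall>f\<in>\<Sigma>. multilinear (ar f) (mu f))"

(* tree_eval_node below is the inductive clause mu(f(t_1,...,t_p)) = mu(f)(mu(t_1),...,mu(t_p)).
   The value for maps without a root or with infinite domain is junk. *)

function tree_eval ::
    "('a \<Rightarrow> nat) \<Rightarrow> ('a \<Rightarrow> ('k::field ^ 'd) list \<Rightarrow> 'k ^ 'd) \<Rightarrow> 'a tree \<Rightarrow> 'k ^ 'd" where
  "tree_eval ar mu t =
     (if finite (dom t) \<and> t [] \<noteq> None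
      then mu (the (t []))
             (map (\<lambda>j. tree_eval ar mu (subtree t j)) [1..<Suc (ar (the (t [])))])
      else 0)"
  by pat_completeness auto
termination
  by (relation "Wellfounded.measure (\<lambda>(ar, mu, t). card (dom t))") (auto intro: card_dom_subtree)

declare tree_eval.simps [simp del]

definition tree_series ::
    "('a \<Rightarrow> nat) \<Rightarrow> ('a \<Rightarrow> ('k::field ^ 'd) list \<Rightarrow> 'k ^ 'd) \<Rightarrow> 'k ^ 'd \<Rightarrow> 'a tree \<Rightarrow> 'k" where
  "tree_series ar mu lam t = scalar_product lam (tree_eval ar mu t)"

definition node :: "'a \<Rightarrow> 'a tree list \<Rightarrow> 'a tree" where
  "node f ts p = (case p of [] \<Rightarrow> Some f
     | j # q \<Rightarrow> if 1 \<le> j \<and> j \<le> length ts then (ts ! (j - 1)) q else None)"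

lemma subtree_node: "i < length ts \<Longrightarrow> subtree (node f ts) (Suc i) = ts ! i"
  by (auto simp: subtree_def node_def)

lemma finite_dom_node:
  assumes "\<forall>t\<in>set ts. finite (dom t)"
  shows "finite (dom (node f ts))"
proof -
  have "dom (node f ts) \<subseteq> insert [] (\<Union>i<length ts. (#) (Suc i) ` dom (ts ! i))"
  proof
    fix p assume "p \<in> dom (node f ts)"
    then show "p \<in> insert [] (\<Union>i<length ts. (#) (Suc i) ` dom (ts ! i))"
    proof (cases p)
      case (Cons j q)
      with \<open>p \<in> dom (node f ts)\<close> have "1 \<le> j" "j \<le> length ts" "q \<in> dom (ts ! (j - 1))"
        by (auto simp: node_def split: if_splits)
      then have "j - 1 < length ts" "p \<in> (#) (Suc (j - 1)) ` dom (ts ! (j - 1))"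
        using Cons by auto
      then show ?thesis by blast
    qed simp
  qed
  moreover have "finite (insert [] (\<Union>i<length ts. (#) (Suc i) ` dom (ts ! i)))"
    using assms by auto
  ultimately show ?thesis by (rule finite_subset)
qed

lemma tree_eval_node:
  assumes "length ts = ar f" "\<forall>t\<in>set ts. tree_over \<Sigma> ar t"
  shows "tree_eval ar mu (node f ts) = mu f (map (tree_eval ar mu) ts)"
proof -
  have "finite (dom (node f ts))"
    using assms(2) by (intro finite_dom_node) (auto simp: tree_over_def)
  moreover have "map (\<lambda>j. tree_eval ar mu (subtree (node f ts) j)) [1..<Suc (ar f)]
      = map (tree_eval ar mu) ts"
    using assms(1) by (intro nth_equalityI) (simp_all add: subtree_node del: upt_Suc)
  moreover have "node f ts [] = Some f"
    by (simp add: node_def)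
  ultimately show ?thesis
    by (subst tree_eval.simps) (simp del: upt_Suc)
qed

section \<open>Hypergraphs\<close>

record ('v, 'x) hypergraph =
  verts :: "'v set"
  label :: "'v \<Rightarrow> 'x"
  hyperedges :: "('v \<times> nat) set set"

definition ports :: "('x \<Rightarrow> nat) \<Rightarrow> ('v, 'x) hypergraph \<Rightarrow> ('v \<times> nat) set" where
  "ports ar G = {(v, j). v \<in> verts G \<and> 1 \<le> j \<and> j \<le> ar (label G v)}"

definition hypergraph_over :: "'x set \<Rightarrow> ('x \<Rightarrow> nat) \<Rightarrow> ('v, 'x) hypergraph \<Rightarrow> bool" where
  "hypergraph_over \<Sigma> ar G \<longleftrightarrow>
     positive_alphabet \<Sigma> ar \<and> finite (verts G) \<and> verts G \<noteq> {} \<and> label G ` verts G \<subseteq> \<Sigma> \<and>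
     partition_on (ports ar G) (hyperedges G)"

(* The new symbol lambda and the new vertex 0 are both rendered by None. *)

definition ext_alphabet :: "'a set \<Rightarrow> 'a option set" where
  "ext_alphabet \<Sigma> = insert None (Some ` \<Sigma>)"

definition ext_arity :: "('a \<Rightarrow> nat) \<Rightarrow> 'a option \<Rightarrow> nat" where
  "ext_arity ar x = (case x of None \<Rightarrow> 1 | Some f \<Rightarrow> ar f + 1)"

definition tree_hypergraph :: "'a tree \<Rightarrow> (nat list option, 'a option) hypergraph" where
  "tree_hypergraph t =
     \<lparr> verts = insert None (Some ` dom t),
       label = (\<lambda>v. case v of None \<Rightarrow> None | Some p \<Rightarrow> Some (the (t p))),
       hyperedges = insert {(None, 1), (Some [], 1)}
         {{(Some p, j + 1), (Some (p @ [j]), 1)} | p j. p @ [j] \<in> dom t} \<rparr>"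

lemma tree_hypergraph_over:
  assumes "ranked_alphabet \<Sigma> ar" "tree_over \<Sigma> ar t"
  shows "hypergraph_over (ext_alphabet \<Sigma>) (ext_arity ar) (tree_hypergraph t)"
proof -
  let ?G = "tree_hypergraph t"
  have fin: "finite (dom t)" and ne: "dom t \<noteq> {}"
    and prefix: "\<And>p q. p @ q \<in> dom t \<Longrightarrow> p \<in> dom t" and ran: "ran t \<subseteq> \<Sigma>"
    and children: "\<And>p. p \<in> dom t \<Longrightarrow> {j. p @ [j] \<in> dom t} = {1..ar (the (t p))}"
    using assms(2) unfolding tree_over_def by blast+
  have root: "[] \<in> dom t" using ne prefix[of "[]"] by auto
  have child_iff: "p @ [j] \<in> dom t \<longleftrightarrow> p \<in> dom t \<and> 1 \<le> j \<and> j \<le> ar (the (t p))" for p j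
  proof (cases "p \<in> dom t")
    case True
    then have "j \<in> {j. p @ [j] \<in> dom t} \<longleftrightarrow> j \<in> {1..ar (the (t p))}"
      using children by simp
    with True show ?thesis by simp
  next
    case False
    then show ?thesis using prefix by blast
  qed
  have ports_eq: "ports (ext_arity ar) ?G =
      insert (None, 1) {(Some p, j) | p j. p \<in> dom t \<and> 1 \<le> j \<and> j \<le> ar (the (t p)) + 1}"
    unfolding ports_def tree_hypergraph_def ext_arity_def by auto
  have edges_eq: "hyperedges ?G = insert {(None, 1), (Some [], 1)}
      {{(Some p, j + 1), (Some (p @ [j]), 1)} | p j. p @ [j] \<in> dom t}"
    by (simp add: tree_hypergraph_def)
  have "\<Union>(hyperedges ?G) = ports (ext_arity ar) ?G"
  proof (intro equalityI subsetI)
    fix x assume "x \<in> \<Union>(hyperedges ?G)"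
    then consider "x = (None, 1)" | "x = (Some [], 1)"
      | p j where "x = (Some p, j + 1) \<or> x = (Some (p @ [j]), 1)" "p @ [j] \<in> dom t"
      unfolding edges_eq by blast
    then show "x \<in> ports (ext_arity ar) ?G"
    proof cases
      case 1
      then show ?thesis unfolding ports_eq by blast
    next
      case 2
      then show ?thesis unfolding ports_eq using root by simp
    next
      case (3 p j)
      then show ?thesis unfolding ports_eq using child_iff[of p j] by auto
    qed
  next
    fix x assume "x \<in> ports (ext_arity ar) ?G"
    then consider "x = (None, 1)"
      | p j where "x = (Some p, j)" "p \<in> dom t" "1 \<le> j" "j \<le> ar (the (t p)) + 1"
      unfolding ports_eq by blast
    then show "x \<in> \<Union>(hyperedges ?G)"
    proof cases
      case 1
      then show ?thesis unfolding edges_eq by blast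
    next
      case (2 p j)
      show ?thesis
      proof (cases "j = 1")
        case True
        show ?thesis
        proof (cases p rule: rev_cases)
          case Nil
          then show ?thesis using 2 True unfolding edges_eq by blast
        next
          case (snoc q i)
          then have "{(Some q, i + 1), (Some (q @ [i]), 1)} \<in> hyperedges ?G"
            using 2 unfolding edges_eq by blast
          then show ?thesis using snoc 2 True by blast
        qed
      next
        case False
        then obtain i where i: "j = i + 1" "1 \<le> i"
          using 2 by (intro that[of "j - 1"]) auto
        then have "{(Some p, i + 1), (Some (p @ [i]), 1)} \<in> hyperedges ?G"
          using 2 child_iff[of p i] unfolding edges_eq by auto
        then show ?thesis using i 2 by blast
      qed
    qed
  qed
  moreover have "disjoint (hyperedges ?G)"
    unfolding edges_eq pairwise_def disjnt_def
    using child_iff by (fastforce simp: insert_commute)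
  moreover have "{} \<notin> hyperedges ?G"
    unfolding edges_eq by auto
  ultimately have "partition_on (ports (ext_arity ar) ?G) (hyperedges ?G)"
    unfolding partition_on_def by blast
  moreover have "positive_alphabet (ext_alphabet \<Sigma>) (ext_arity ar)"
    using assms(1)
    by (auto simp: positive_alphabet_def ranked_alphabet_def ext_alphabet_def ext_arity_def)
  moreover have "label ?G ` verts ?G \<subseteq> ext_alphabet \<Sigma>"
    using ran by (auto simp: tree_hypergraph_def ext_alphabet_def ran_def)
  ultimately show ?thesis
    using fin by (simp add: hypergraph_over_def tree_hypergraph_def)
qed

section \<open>Hypergraph weighted models\<close>

definition is_product :: "('k::field ^ 'd \<Rightarrow> 'k ^ 'd \<Rightarrow> 'k ^ 'd) \<Rightarrow> bool" where
  "is_product m \<longleftrightarrow>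
     (\<forall>u. Vector_Spaces.linear (*s) (*s) (m u)) \<and>
     (\<forall>v. Vector_Spaces.linear (*s) (*s) (\<lambda>u. m u v)) \<and>
     (\<forall>u v w. m (m u v) w = m u (m v w)) \<and>
     (\<forall>u v. m u v = m v u)"

(* Iterated product over a finite non-empty index set. A product need not have a unit, so the
   fold runs over options, None standing for the empty product; see bigprod_singleton and
   bigprod_insert. *)

definition bigprod :: "('b \<Rightarrow> 'b \<Rightarrow> 'b) \<Rightarrow> ('i \<Rightarrow> 'b) \<Rightarrow> 'i set \<Rightarrow> 'b" where
  "bigprod m f A =
     the (Finite_Set.fold (\<lambda>i acc. Some (case acc of None \<Rightarrow> f i | Some y \<Rightarrow> m (f i) y)) None A)"

lemma bigprod_comp_fun_commute:
  assumes "\<And>u v w. m (m u v) w = m u (m v w)" "\<And>u v. m u v = m v u"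
  shows "comp_fun_commute (\<lambda>i acc. Some (case acc of None \<Rightarrow> f i | Some y \<Rightarrow> m (f i) y))"
proof
  have "m (f y) (m (f x) z) = m (f x) (m (f y) z)" for x y z
    by (metis assms)
  then show "(\<lambda>acc. Some (case acc of None \<Rightarrow> f y | Some z \<Rightarrow> m (f y) z)) \<circ>
      (\<lambda>acc. Some (case acc of None \<Rightarrow> f x | Some z \<Rightarrow> m (f x) z)) =
      (\<lambda>acc. Some (case acc of None \<Rightarrow> f x | Some z \<Rightarrow> m (f x) z)) \<circ>
      (\<lambda>acc. Some (case acc of None \<Rightarrow> f y | Some z \<Rightarrow> m (f y) z))" for x y
    using assms(2) by (auto simp: fun_eq_iff split: option.splits)
qed

lemma bigprod_singleton:
  assumes "is_product m"
  shows "bigprod m f {i} = f i"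
proof -
  interpret comp_fun_commute "\<lambda>i acc. Some (case acc of None \<Rightarrow> f i | Some y \<Rightarrow> m (f i) y)"
    using assms by (intro bigprod_comp_fun_commute) (auto simp: is_product_def)
  show ?thesis by (simp add: bigprod_def)
qed

lemma bigprod_insert:
  assumes "is_product m" "finite A" "A \<noteq> {}" "i \<notin> A"
  shows "bigprod m f (insert i A) = m (f i) (bigprod m f A)"
proof -
  let ?g = "\<lambda>i acc. Some (case acc of None \<Rightarrow> f i | Some y \<Rightarrow> m (f i) y)"
  interpret comp_fun_commute ?g
    using assms(1) by (intro bigprod_comp_fun_commute) (auto simp: is_product_def)
  obtain a B where "A = insert a B" "a \<notin> B"
    using assms(3) by (meson Set.set_insert ex_in_conv)
  then have "\<exists>y. Finite_Set.fold ?g None A = Some y"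
    using assms(2) by simp
  then show ?thesis
    using assms by (auto simp: bigprod_def)
qed

(* tensor M x is used only on index lists of length ar x. *)

record ('x, 'k, 'd) hwm =
  tensor :: "'x \<Rightarrow> 'd list \<Rightarrow> 'k"
  hprod :: "'k ^ 'd \<Rightarrow> 'k ^ 'd \<Rightarrow> 'k ^ 'd"
  alpha :: "'k ^ 'd"

definition hwm_over :: "'x set \<Rightarrow> ('x \<Rightarrow> nat) \<Rightarrow> ('x, 'k::field, 'd::finite) hwm \<Rightarrow> bool" where
  "hwm_over \<Sigma> ar M \<longleftrightarrow> positive_alphabet \<Sigma> ar \<and> is_product (hprod M)"

definition hwm_series ::
    "('x \<Rightarrow> nat) \<Rightarrow> ('x, 'k::field, 'd::finite) hwm \<Rightarrow> ('v, 'x) hypergraph \<Rightarrow> 'k" where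
  "hwm_series ar M G =
     (\<Sum>\<gamma> \<in> ports ar G \<rightarrow>\<^sub>E UNIV.
        (\<Prod>v\<in>verts G. tensor M (label G v) (map (\<lambda>j. \<gamma> (v, j)) [1..<Suc (ar (label G v))])) *
        (\<Prod>h\<in>hyperedges G. scalar_product (alpha M) (bigprod (hprod M) (\<lambda>p. axis (\<gamma> p) 1) h)))"

definition id_product :: "'k::field ^ 'd \<Rightarrow> 'k ^ 'd \<Rightarrow> 'k ^ 'd" where
  "id_product u v =
     (\<Sum>i\<in>UNIV. \<Sum>j\<in>UNIV. (u $ i * v $ j) *s (if i = j then axis i 1 else 0))"

lemma id_product_nth: "id_product u v $ i = u $ i * v $ i"
  for u v :: "'k::field ^ 'd"
proof -
  have "(\<Sum>j\<in>UNIV. (u $ l * v $ j) *s (if l = j then axis l 1 else 0)) $ i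
      = (if l = i then u $ i * v $ i else 0)" for l
  proof -
    have "((u $ l * v $ j) *s (if l = j then axis l (1::'k) else 0)) $ i
        = (if j = l then (if l = i then u $ i * v $ i else 0) else 0)" for j
      by (auto simp: axis_def)
    then show ?thesis by (simp add: sum_component)
  qed
  then show ?thesis by (simp add: id_product_def sum_component)
qed

lemma id_product_axis:
  "id_product (axis i 1) (axis j 1) = (if i = j then axis i 1 else (0 :: 'k::field ^ 'd))"
  by (auto simp: vec_eq_iff id_product_nth axis_def)

lemma is_product_id_product: "is_product (id_product :: 'k::field ^ 'd \<Rightarrow> _)"
  by (auto simp: is_product_def vec_eq_iff id_product_nth algebra_simps
      Vector_Spaces.linear_iff vec.vector_space_axioms)

definition tree_hwm ::
    "('a \<Rightarrow> ('k::field ^ 'd::finite) list \<Rightarrow> 'k ^ 'd) \<Rightarrow> 'k ^ 'd \<Rightarrow> ('a option, 'k, 'd) hwm" where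
  "tree_hwm mu lam =
     \<lparr> tensor = (\<lambda>x is. case x of
         None \<Rightarrow> lam $ hd is
       | Some f \<Rightarrow> scalar_product (axis (hd is) 1) (mu f (map (\<lambda>i. axis i 1) (tl is)))),
       hprod = id_product,
       alpha = (\<chi> i. 1) \<rparr>"

lemma tree_hwm_over:
  assumes "ranked_alphabet \<Sigma> ar"
  shows "hwm_over (ext_alphabet \<Sigma>) (ext_arity ar) (tree_hwm mu lam)"
  using assms is_product_id_product
  by (auto simp: hwm_over_def tree_hwm_def positive_alphabet_def ranked_alphabet_def
      ext_alphabet_def ext_arity_def)

end

theory Submission
  imports Defs
begin

text \<open>
  The identity product and the all-ones vector force the two ports of every hyperedge of the
  hypergraph of a tree to carry the same index, so a nonzero summand is determined by a colouring
  of the positions: the colour of a position is the index on the hyperedge above it. The resulting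
  sum over colourings is evaluated along growing prefix-closed sets of positions: colour only the
  positions in the set, and plug the value of the whole subtree into each argument just outside it.
  Adding one position expands one argument in the canonical basis, so by linearity in that argument
  the sum does not change. It is the value of the series for the set consisting of the root, and
  the sum over all colourings for the set of all positions.
\<close>

section \<open>Expansion of multilinear maps in the canonical basis\<close>

lemma linear_basis_expansion:
  fixes h :: "'k::field ^ 'd::finite \<Rightarrow> 'k ^ 'e"
  assumes "Vector_Spaces.linear (*s) (*s) h"
  shows "h v = (\<Sum>i\<in>UNIV. v $ i *s h (axis i 1))"
proof -
  interpret Vector_Spaces.linear "(*s)" "(*s)" h by (fact assms)
  have "h v = h (\<Sum>i\<in>UNIV. v $ i *s axis i 1)"
    by (simp add: basis_expansion)
  also have "\<dots> = (\<Sum>i\<in>UNIV. v $ i *s h (axis i 1))"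
    by (simp add: sum scale)
  finally show ?thesis .
qed

text \<open>Linearity in slot \<open>i\<close> alone is used. A single coordinate \<open>k\<close>
  is taken because the summands to be rewritten are products of scalars.\<close>

lemma multilinear_expand_arg:
  fixes m :: "('k::field ^ 'd::finite) list \<Rightarrow> 'k ^ 'd"
  assumes "multilinear (length vs) m" "i < length vs"
  shows "m vs $ k = (\<Sum>l\<in>UNIV. vs ! i $ l * m (vs[i := axis l 1]) $ k)"
proof -
  have "Vector_Spaces.linear (*s) (*s) (\<lambda>v. m (vs[i := v]))"
    using assms by (auto simp: multilinear_def)
  from linear_basis_expansion[OF this, of "vs ! i"] show ?thesis
    by (simp add: sum_component)
qed

lemma scalar_product_axis_left:
  fixes v :: "'k::field ^ 'n::finite"
  shows "scalar_product (axis i 1) v = v $ i"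
proof -
  have "(axis i 1 :: 'k ^ 'n) $ j * v $ j = (if j = i then v $ i else 0)" for j
    by (auto simp: axis_def)
  then show ?thesis by (simp add: scalar_product_def)
qed

section \<open>Positions of a tree and values of its subtrees\<close>

lemma tree_child_iff:
  assumes "tree_over \<Sigma> ar t"
  shows "p @ [j] \<in> dom t \<longleftrightarrow> p \<in> dom t \<and> 1 \<le> j \<and> j \<le> ar (the (t p))"
proof (cases "p \<in> dom t")
  case True
  then have "{j. p @ [j] \<in> dom t} = {1..ar (the (t p))}"
    using assms by (auto simp only: tree_over_def)
  then have "j \<in> {j. p @ [j] \<in> dom t} \<longleftrightarrow> j \<in> {1..ar (the (t p))}"
    by simp
  with True show ?thesis by simp
next
  case False
  then show ?thesis using assms unfolding tree_over_def by blast
qed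

lemma tree_root_in_dom:
  assumes "tree_over \<Sigma> ar t"
  shows "[] \<in> dom t"
  using assms unfolding tree_over_def by (metis append_Nil ex_in_conv)

text \<open>This is the inductive clause at an arbitrary position. Writing the subtree as a shift of
  \<open>t\<close> by \<open>p\<close> avoids iterating \<open>subtree\<close>; its domain is finite
  because prepending \<open>p\<close> is injective.\<close>

lemma tree_eval_at:
  assumes "finite (dom t)" "p \<in> dom t"
  shows "tree_eval ar mu (\<lambda>q. t (p @ q)) =
    mu (the (t p)) (map (\<lambda>j. tree_eval ar mu (\<lambda>q. t (p @ j # q))) [1..<Suc (ar (the (t p)))])"
proof -
  have "(@) p ` dom (\<lambda>q. t (p @ q)) \<subseteq> dom t"
    by auto
  then have "finite (dom (\<lambda>q. t (p @ q)))"
    using assms(1) by (metis finite_imageD finite_subset inj_on_def same_append_eq)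
  then show ?thesis
    using assms(2) by (subst tree_eval.simps) (auto simp: subtree_def simp del: upt_Suc)
qed

section \<open>Sums over colourings of prefix-closed sets of positions\<close>

text \<open>For \<open>S = dom t\<close> and \<open>p\<close> in \<open>S\<close> all arguments are
  basis vectors, so applying \<open>mu\<close> gives entries of the tensor at \<open>p\<close>; for
  \<open>S = {[]}\<close> all are values of subtrees.\<close>

definition cut_args ::
    "('a \<Rightarrow> nat) \<Rightarrow> ('a \<Rightarrow> ('k::field ^ 'd) list \<Rightarrow> 'k ^ 'd) \<Rightarrow> 'a tree \<Rightarrow> nat list set \<Rightarrow>
      (nat list \<Rightarrow> 'd) \<Rightarrow> nat list \<Rightarrow> ('k ^ 'd) list" where
  "cut_args ar mu t S c p =
     map (\<lambda>j. if p @ [j] \<in> S then axis (c (p @ [j])) 1 else tree_eval ar mu (\<lambda>q. t (p @ j # q)))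
       [1..<Suc (ar (the (t p)))]"

text \<open>The factor \<open>lam $ c []\<close> is the weight of the extra vertex, whose only port
  shares a hyperedge with the root. It is meaningful when \<open>[]\<close> lies in
  \<open>S\<close>.\<close>

definition cut_sum ::
    "('a \<Rightarrow> nat) \<Rightarrow> ('a \<Rightarrow> ('k::field ^ 'd::finite) list \<Rightarrow> 'k ^ 'd) \<Rightarrow> 'k ^ 'd \<Rightarrow> 'a tree \<Rightarrow>
      nat list set \<Rightarrow> 'k" where
  "cut_sum ar mu lam t S =
     (\<Sum>c \<in> S \<rightarrow>\<^sub>E UNIV. lam $ c [] * (\<Prod>p\<in>S. mu (the (t p)) (cut_args ar mu t S c p) $ c p))"

text \<open>Since \<open>x\<close> is outside \<open>S\<close>, extending \<open>c\<close> by
  \<open>x := i\<close> is injective in the pair \<open>(i, c)\<close>. The new colour becomes the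
  inner sum, so that two sums over colourings of \<open>S\<close> can be compared term by
  term.\<close>

lemma sum_PiE_insert:
  assumes "x \<notin> S"
  shows "(\<Sum>c \<in> insert x S \<rightarrow>\<^sub>E UNIV. g c) = (\<Sum>c \<in> S \<rightarrow>\<^sub>E UNIV. \<Sum>i\<in>UNIV. g (c(x := i)))"
proof -
  have "(\<Sum>c \<in> insert x S \<rightarrow>\<^sub>E UNIV. g c) =
      (\<Sum>(i, c) \<in> UNIV \<times> (S \<rightarrow>\<^sub>E UNIV). g (c(x := i)))"
    unfolding PiE_insert_eq
    by (subst sum.reindex) (use inj_combinator[OF assms, of "\<lambda>_. UNIV"] in \<open>auto simp: case_prod_unfold\<close>)
  also have "\<dots> = (\<Sum>i\<in>UNIV. \<Sum>c \<in> S \<rightarrow>\<^sub>E UNIV. g (c(x := i)))"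
    by (simp add: sum.cartesian_product)
  also have "\<dots> = (\<Sum>c \<in> S \<rightarrow>\<^sub>E UNIV. \<Sum>i\<in>UNIV. g (c(x := i)))"
    by (rule sum.swap)
  finally show ?thesis .
qed

lemma cut_sum_insert:
  fixes mu :: "'a \<Rightarrow> ('k::field ^ 'd::finite) list \<Rightarrow> 'k ^ 'd"
  assumes rep: "tree_representation \<Sigma> ar mu" and tree: "tree_over \<Sigma> ar t"
    and S: "finite S" "p \<in> S" and q: "p @ [j] \<in> dom t" "p @ [j] \<notin> S"
    and leaf: "\<And>i. p @ [j, i] \<notin> S"
  shows "cut_sum ar mu lam t (insert (p @ [j]) S) = cut_sum ar mu lam t S"
proof -
  let ?q = "p @ [j]" and ?S = "insert (p @ [j]) S"
  have j: "p \<in> dom t" "1 \<le> j" "j \<le> ar (the (t p))"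
    using q(1) tree_child_iff[OF tree] by blast+
  have fin: "finite (dom t)" and "ran t \<subseteq> \<Sigma>"
    using tree by (auto simp: tree_over_def)
  then have "the (t p) \<in> \<Sigma>"
    using j(1) by (auto simp: ran_def)
  then have lin: "multilinear (ar (the (t p))) (mu (the (t p)))"
    using rep by (simp add: tree_representation_def)
  have summand: "(\<Sum>i\<in>UNIV. lam $ (c(?q := i)) [] *
        (\<Prod>r\<in>?S. mu (the (t r)) (cut_args ar mu t ?S (c(?q := i)) r) $ (c(?q := i)) r)) =
      lam $ c [] * (\<Prod>r\<in>S. mu (the (t r)) (cut_args ar mu t S c r) $ c r)" for c
  proof -
    let ?v = "tree_eval ar mu (\<lambda>r. t (?q @ r))" and ?vs = "cut_args ar mu t S c p"
    define R where "R = (\<Prod>r\<in>S - {p}. mu (the (t r)) (cut_args ar mu t S c r) $ c r)"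
    have len: "length ?vs = ar (the (t p))"
      by (simp add: cut_args_def)
    have nth: "?vs ! (j - 1) = ?v"
      using j q(2) by (simp add: cut_args_def nth_upt del: upt_Suc)
    \<comment> \<open>No child of the new position is in the enlarged set, so all its arguments are
      values of subtrees, whatever the colour \<open>i\<close>.\<close>
    have new: "mu (the (t ?q)) (cut_args ar mu t ?S (c(?q := i)) ?q) = ?v" for i
      using tree_eval_at[OF fin q(1), of ar mu] leaf
      by (simp add: cut_args_def del: upt_Suc)
    have parent: "cut_args ar mu t ?S (c(?q := i)) p = ?vs[j - 1 := axis i 1]" for i
    proof (rule nth_equalityI)
      fix k assume "k < length (cut_args ar mu t ?S (c(?q := i)) p)"
      then show "cut_args ar mu t ?S (c(?q := i)) p ! k = ?vs[j - 1 := axis i 1] ! k"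
        using j by (cases "k = j - 1") (auto simp: cut_args_def nth_upt simp del: upt_Suc)
    qed (simp add: cut_args_def)
    \<comment> \<open>The new position is a child of \<open>p\<close> only, so no other argument
      list changes.\<close>
    have other: "cut_args ar mu t ?S (c(?q := i)) r = cut_args ar mu t S c r" if "r \<noteq> p" for i r
      using that by (simp add: cut_args_def del: upt_Suc)
    have "(\<Prod>r\<in>?S. mu (the (t r)) (cut_args ar mu t ?S (c(?q := i)) r) $ (c(?q := i)) r) =
        ?v $ i * (mu (the (t p)) (?vs[j - 1 := axis i 1]) $ c p * R)" for i
    proof -
      let ?f = "\<lambda>r. mu (the (t r)) (cut_args ar mu t ?S (c(?q := i)) r) $ (c(?q := i)) r"
      have "prod ?f ?S = ?f ?q * (?f p * prod ?f (S - {p}))"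
        using S q(2) by (simp add: prod.remove[of S p])
      moreover have "prod ?f (S - {p}) = R"
        unfolding R_def by (rule prod.cong) (use q(2) other in auto)
      ultimately show ?thesis by (simp add: new parent)
    qed
    \<comment> \<open>The new position is a non-empty word, so the root keeps its colour.\<close>
    moreover have "(c(?q := i)) [] = c []" for i
      by simp
    ultimately have "(\<Sum>i\<in>UNIV. lam $ (c(?q := i)) [] *
        (\<Prod>r\<in>?S. mu (the (t r)) (cut_args ar mu t ?S (c(?q := i)) r) $ (c(?q := i)) r)) =
        lam $ c [] * ((\<Sum>i\<in>UNIV. ?v $ i * mu (the (t p)) (?vs[j - 1 := axis i 1]) $ c p) * R)"
      by (simp add: sum_distrib_left sum_distrib_right mult_ac)
    also have "(\<Sum>i\<in>UNIV. ?v $ i * mu (the (t p)) (?vs[j - 1 := axis i 1]) $ c p) =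
        mu (the (t p)) ?vs $ c p"
      using multilinear_expand_arg[of ?vs "mu (the (t p))" "j - 1" "c p"] lin j len nth by simp
    finally show ?thesis
      by (simp only: R_def prod.remove[OF S])
  qed
  show ?thesis
    unfolding cut_sum_def sum_PiE_insert[OF q(2)] summand ..
qed

text \<open>A colouring of the root is a single index, and summing over it is the scalar product
  with \<open>lam\<close>.\<close>

lemma cut_sum_root:
  fixes mu :: "'a \<Rightarrow> ('k::field ^ 'd::finite) list \<Rightarrow> 'k ^ 'd"
  assumes "tree_over \<Sigma> ar t"
  shows "cut_sum ar mu lam t {[]} = tree_series ar mu lam t"
proof -
  have "finite (dom t)"
    using assms by (simp add: tree_over_def)
  from tree_eval_at[OF this tree_root_in_dom[OF assms], of ar mu]
  have "tree_eval ar mu t = mu (the (t [])) (cut_args ar mu t {[]} c [])" for c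
    by (simp add: cut_args_def del: upt_Suc)
  then show ?thesis
    by (simp add: cut_sum_def sum_PiE_insert tree_series_def scalar_product_def)
qed

lemma cut_sum_eq_tree_series:
  fixes mu :: "'a \<Rightarrow> ('k::field ^ 'd::finite) list \<Rightarrow> 'k ^ 'd"
  assumes rep: "tree_representation \<Sigma> ar mu" and tree: "tree_over \<Sigma> ar t"
  shows "S \<subseteq> dom t \<Longrightarrow> [] \<in> S \<Longrightarrow> (\<And>p q. p @ q \<in> S \<Longrightarrow> p \<in> S) \<Longrightarrow>
    cut_sum ar mu lam t S = tree_series ar mu lam t"
proof (induction "card S" arbitrary: S rule: less_induct)
  case less
  have fin: "finite S"
    using less.prems(1) tree by (auto simp: tree_over_def intro: finite_subset)
  show ?case
  proof (cases "S = {[]}")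
    case True
    then show ?thesis using cut_sum_root[OF tree] by simp
  next
    case False
    have "S \<noteq> {}" using less.prems(2) by blast
    \<comment> \<open>A longest position has no child in \<open>S\<close>; removing it keeps
      \<open>S\<close> prefix-closed and meets the leaf condition of
      \<open>cut_sum_insert\<close>.\<close>
    then have "Max (length ` S) \<in> length ` S"
      using fin by (intro Max_in) auto
    then obtain r where r: "r \<in> S" "length r = Max (length ` S)"
      by auto
    then have r: "r \<in> S" "\<And>s. s \<in> S \<Longrightarrow> length s \<le> length r"
      using fin by auto
    obtain s where "s \<in> S" "s \<noteq> []"
      using False less.prems(2) by blast
    then have "r \<noteq> []" using r(2) by fastforce
    then obtain p j where pj: "r = p @ [j]"
      by (cases r rule: rev_cases) auto
    define S' where "S' = S - {r}"
    have S: "S = insert (p @ [j]) S'"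
      using r(1) pj by (auto simp: S'_def)
    have "cut_sum ar mu lam t S' = tree_series ar mu lam t"
    proof (rule less.hyps)
      show "card S' < card S"
        using r(1) fin by (simp add: S'_def card_gt_0_iff \<open>S \<noteq> {}\<close>)
      show "S' \<subseteq> dom t" "[] \<in> S'"
        using less.prems \<open>r \<noteq> []\<close> by (auto simp: S'_def)
      show "a \<in> S'" if "a @ b \<in> S'" for a b
      proof -
        have "a @ b \<in> S" "a @ b \<noteq> r" using that by (auto simp: S'_def)
        \<comment> \<open>If \<open>a = r\<close>, maximality of the length forces
          \<open>b = []\<close>, hence \<open>a @ b = r\<close>.\<close>
        moreover have "a \<noteq> r"
          using r(2)[OF \<open>a @ b \<in> S\<close>] \<open>a @ b \<noteq> r\<close> by auto
        ultimately show ?thesis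
          using less.prems(3) by (auto simp: S'_def)
      qed
    qed
    moreover have "cut_sum ar mu lam t (insert (p @ [j]) S') = cut_sum ar mu lam t S'"
    proof (rule cut_sum_insert[OF rep tree])
      show "finite S'" using fin by (simp add: S'_def)
      show "p \<in> S'" "p @ [j] \<in> dom t" "p @ [j] \<notin> S'"
        using less.prems r(1) pj by (auto simp: S'_def)
      show "p @ [j, i] \<notin> S'" for i
        using r(2)[of "p @ [j, i]"] pj by (auto simp: S'_def)
    qed
    ultimately show ?thesis by (simp add: S)
  qed
qed

section \<open>Index labellings of the ports of the tree hypergraph\<close>

text \<open>Distinct basis vectors have identity product 0, equal ones reproduce themselves, and the
  coordinates of a basis vector sum to 1.\<close>

lemma edge_factor:
  fixes \<gamma> :: "'p \<Rightarrow> 'd::finite"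
  assumes "x \<noteq> y"
  shows "scalar_product ((\<chi> i. 1) :: 'k::field ^ 'd)
      (bigprod id_product (\<lambda>p. axis (\<gamma> p) 1) {x, y}) =
    (if \<gamma> x = \<gamma> y then 1 else 0)"
proof -
  have "(\<Sum>i\<in>UNIV. (axis a 1 :: 'k ^ 'd) $ i) = 1" for a :: 'd
    by (simp add: axis_def)
  then show ?thesis
    using assms
    by (simp add: bigprod_insert bigprod_singleton is_product_id_product id_product_axis
        scalar_product_def)
qed

text \<open>This is the position at the lower end of the hyperedge through a port. Port 1 points to
  the parent, hence the shift by one for children; the port of the extra vertex belongs to the
  root.\<close>

fun port_position :: "nat list option \<times> nat \<Rightarrow> nat list" where
  "port_position (None, j) = []"
| "port_position (Some p, j) = (if j = 1 then p else p @ [j - 1])"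

text \<open>Here \<open>x\<close> is the upper end of \<open>h\<close>. Both ends have
  \<open>port_position\<close> equal to \<open>p\<close>, which makes labellings induced by
  colourings constant on hyperedges.\<close>

lemma tree_hypergraph_edge:
  assumes "tree_over \<Sigma> ar t" "h \<in> hyperedges (tree_hypergraph t)"
  obtains x p where "h = {x, (Some p, 1)}" "x \<noteq> (Some p, 1)" "p \<in> dom t"
    "x \<in> ports (ext_arity ar) (tree_hypergraph t)" "port_position x = p"
proof -
  from assms(2) consider "h = {(None, 1), (Some [], 1)}"
    | p j where "h = {(Some p, j + 1), (Some (p @ [j]), 1)}" "p @ [j] \<in> dom t"
    by (auto simp: tree_hypergraph_def)
  then show thesis
  proof cases
    case 1
    then show thesis
      using tree_root_in_dom[OF assms(1)]
      by (intro that[of "(None, 1)" "[]"]) (auto simp: ports_def tree_hypergraph_def ext_arity_def)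
  next
    case (2 p j)
    with tree_child_iff[OF assms(1), of p j] show thesis
      by (intro that[of "(Some p, j + 1)" "p @ [j]"])
        (auto simp: ports_def tree_hypergraph_def ext_arity_def)
  qed
qed

text \<open>Conversely, a port either is the first port of its position or shares a hyperedge with
  it. A labelling constant on hyperedges is thus determined by its values on first ports.\<close>

lemma tree_hypergraph_port_edge:
  assumes "tree_over \<Sigma> ar t" "x \<in> ports (ext_arity ar) (tree_hypergraph t)"
  shows "port_position x \<in> dom t"
    and "x \<noteq> (Some (port_position x), 1) \<Longrightarrow>
      {x, (Some (port_position x), 1)} \<in> hyperedges (tree_hypergraph t)"
proof -
  from assms(2) consider "x = (None, 1)"
    | p j where "x = (Some p, j)" "p \<in> dom t" "1 \<le> j" "j \<le> ar (the (t p)) + 1"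
    by (fastforce simp: ports_def tree_hypergraph_def ext_arity_def)
  then consider "x = (None, 1)"
    | p where "x = (Some p, 1)" "p \<in> dom t"
    | p j where "x = (Some p, j + 1)" "p @ [j] \<in> dom t"
  proof cases
    case 1
    then show thesis by (rule that(1))
  next
    case (2 p j)
    show thesis
    proof (cases "j = 1")
      case True
      with 2 show thesis by (intro that(2)) auto
    next
      case False
      with 2 show thesis
        using tree_child_iff[OF assms(1), of p "j - 1"] by (intro that(3)[of p "j - 1"]) auto
    qed
  qed
  note cases = this
  show "port_position x \<in> dom t"
    using cases
    by cases (use tree_root_in_dom[OF assms(1)] tree_child_iff[OF assms(1)] in auto)
  show "{x, (Some (port_position x), 1)} \<in> hyperedges (tree_hypergraph t)"
    if "x \<noteq> (Some (port_position x), 1)"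
    using cases
  proof cases
    case (3 p j)
    then have "j \<noteq> 0" using tree_child_iff[OF assms(1), of p j] by auto
    then show ?thesis using 3 by (auto simp: tree_hypergraph_def)
  qed (use that in \<open>auto simp: tree_hypergraph_def\<close>)
qed

lemma hwm_series_tree_hypergraph:
  fixes mu :: "'a \<Rightarrow> ('k::field ^ 'd::finite) list \<Rightarrow> 'k ^ 'd"
  assumes tree: "tree_over \<Sigma> ar t"
  shows "hwm_series (ext_arity ar) (tree_hwm mu lam) (tree_hypergraph t) =
    cut_sum ar mu lam t (dom t)"
proof -
  let ?G = "tree_hypergraph t" and ?M = "tree_hwm mu lam"
  let ?P = "ports (ext_arity ar) ?G" and ?D = "dom t"
  define nodes where "nodes \<gamma> = (\<Prod>v\<in>verts ?G. tensor ?M (label ?G v)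
      (map (\<lambda>j. \<gamma> (v, j)) [1..<Suc (ext_arity ar (label ?G v))]))" for \<gamma>
  define edges where "edges \<gamma> = (\<Prod>h\<in>hyperedges ?G. scalar_product (alpha ?M)
      (bigprod (hprod ?M) (\<lambda>p. axis (\<gamma> p) 1) h))" for \<gamma> :: "_ \<Rightarrow> 'd"
  \<comment> \<open>The restriction makes \<open>lift c\<close> one of the extensional labellings
    over which the series sums.\<close>
  define lift where "lift c = restrict (c \<circ> port_position) ?P" for c :: "nat list \<Rightarrow> 'd"
  have fin_D: "finite ?D"
    using tree by (simp add: tree_over_def)
  have "?P \<subseteq> insert (None, 1) (Sigma (Some ` ?D) (\<lambda>v. {1..ar (the (t (the v))) + 1}))"
    by (auto simp: ports_def tree_hypergraph_def ext_arity_def)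
  then have fin_P: "finite ?P"
    using fin_D by (auto intro: finite_subset)
  \<comment> \<open>A hyperedge between positions is determined by its lower position
    \<open>r\<close>: the parent is \<open>butlast r\<close> and the child number is
    \<open>last r\<close>.\<close>
  have "{{(Some p, j + 1), (Some (p @ [j]), 1)} | p j. p @ [j] \<in> ?D} \<subseteq>
      (\<lambda>r. {(Some (butlast r), last r + 1), (Some r, 1)}) ` ?D"
  proof clarify
    fix p j y assume "t (p @ [j]) = Some y"
    then show "{(Some p, j + 1), (Some (p @ [j]), 1)} \<in>
        (\<lambda>r. {(Some (butlast r), last r + 1), (Some r, 1)}) ` ?D"
      by (intro image_eqI[of _ _ "p @ [j]"]) auto
  qed
  then have fin_E: "finite (hyperedges ?G)"
    using finite_subset[OF _ finite_imageI[OF fin_D]] by (simp add: tree_hypergraph_def)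
  have port: "(Some p, 1) \<in> ?P" if "p \<in> ?D" for p
    using that by (auto simp: ports_def tree_hypergraph_def ext_arity_def)
  have factor: "scalar_product (alpha ?M) (bigprod (hprod ?M) (\<lambda>p. axis (\<gamma> p) 1) {x, y}) =
      (if \<gamma> x = \<gamma> y then 1 else 0)" if "x \<noteq> y" for x y and \<gamma> :: "_ \<Rightarrow> 'd"
    using edge_factor[OF that, where 'k = 'k and \<gamma> = \<gamma>] by (simp add: tree_hwm_def)
  have edges_lift: "edges (lift c) = 1" for c
    unfolding edges_def
  proof (rule prod.neutral, rule ballI)
    fix h assume "h \<in> hyperedges ?G"
    then obtain x p where x: "h = {x, (Some p, 1)}" "x \<noteq> (Some p, 1)" "p \<in> ?D" "x \<in> ?P"
      "port_position x = p"
      by (rule tree_hypergraph_edge[OF tree])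
    then have "lift c x = lift c (Some p, 1)"
      using port by (simp add: lift_def)
    then show "scalar_product (alpha ?M) (bigprod (hprod ?M) (\<lambda>p. axis (lift c p) 1) h) = 1"
      using x(1,2) factor[of x "(Some p, 1)"] by simp
  qed
  have edges_0: "edges \<gamma> = 0" if \<gamma>: "\<gamma> \<in> ?P \<rightarrow>\<^sub>E UNIV" "\<gamma> \<notin> lift ` (?D \<rightarrow>\<^sub>E UNIV)" for \<gamma>
  proof -
    \<comment> \<open>The only candidate colouring is read off the first ports. If its lift differs
      from \<open>\<gamma>\<close>, they differ at a port, since both are undefined elsewhere; the
      hyperedge of that port then contributes the factor 0.\<close>
    define c where "c = restrict (\<lambda>p. \<gamma> (Some p, 1)) ?D"
    have "c \<in> ?D \<rightarrow>\<^sub>E UNIV" by (simp add: c_def)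
    then have "lift c \<noteq> \<gamma>" using \<gamma>(2) by blast
    then obtain x where x: "lift c x \<noteq> \<gamma> x" by blast
    have "x \<in> ?P"
    proof (rule ccontr)
      assume "x \<notin> ?P"
      then show False using x PiE_arb[OF \<gamma>(1)] by (simp add: lift_def)
    qed
    note edge = tree_hypergraph_port_edge[OF tree this]
    have ne: "\<gamma> x \<noteq> \<gamma> (Some (port_position x), 1)"
      using x \<open>x \<in> ?P\<close> edge(1) by (simp add: lift_def c_def)
    then have "x \<noteq> (Some (port_position x), 1)" by metis
    from edge(2)[OF this] factor[OF this, of \<gamma>] ne show ?thesis
      unfolding edges_def using fin_E by (intro prod_zero) auto
  qed
  have nodes_lift: "nodes (lift c) =
      lam $ c [] * (\<Prod>p\<in>?D. mu (the (t p)) (cut_args ar mu t ?D c p) $ c p)" for c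
  proof -
    have "tensor ?M (Some (the (t p)))
        (map (\<lambda>j. lift c (Some p, j)) [1..<Suc (ar (the (t p)) + 1)]) =
        mu (the (t p)) (cut_args ar mu t ?D c p) $ c p" if p: "p \<in> ?D" for p
    proof -
      have "lift c (Some p, Suc j) = c (p @ [j])" "p @ [j] \<in> ?D"
        if "j \<in> {1..ar (the (t p))}" for j
        using that p tree_child_iff[OF tree, of p j]
        by (auto simp: lift_def ports_def tree_hypergraph_def ext_arity_def)
      then have "map (\<lambda>j. axis (lift c (Some p, Suc j)) 1) [1..<Suc (ar (the (t p)))] =
          cut_args ar mu t ?D c p"
        by (auto simp: cut_args_def simp del: upt_Suc)
      \<comment> \<open>Port 1 carries the output index of the tensor, port \<open>Suc j\<close> the
        index of its \<open>j\<close>-th argument.\<close>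
      moreover have "[1..<Suc (ar (the (t p)) + 1)] = 1 # map Suc [1..<Suc (ar (the (t p)))]"
        by (subst map_Suc_upt) (simp add: upt_conv_Cons)
      moreover have "lift c (Some p, 1) = c p"
        using port[OF p] by (simp add: lift_def)
      ultimately show ?thesis
        by (simp add: tree_hwm_def scalar_product_axis_left comp_def del: upt_Suc)
    qed
    moreover have "[Suc 0..<Suc (Suc 0)] = [1]"
      by simp
    moreover have "lift c (None, 1) = c []"
      by (simp add: lift_def ports_def tree_hypergraph_def ext_arity_def)
    ultimately show ?thesis
      using fin_D
      by (simp add: nodes_def tree_hypergraph_def ext_arity_def prod.reindex tree_hwm_def
          del: upt_Suc)
  qed
  have inj: "inj_on lift (?D \<rightarrow>\<^sub>E UNIV)"
  proof (rule inj_onI)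
    fix c c' assume c: "c \<in> ?D \<rightarrow>\<^sub>E UNIV" "c' \<in> ?D \<rightarrow>\<^sub>E UNIV" and eq: "lift c = lift c'"
    have "c p = c' p" if "p \<in> ?D" for p
      using fun_cong[OF eq, of "(Some p, 1)"] port[OF that] by (simp add: lift_def)
    then show "c = c'" by (rule PiE_ext[OF c])
  qed
  have "hwm_series (ext_arity ar) ?M ?G = (\<Sum>\<gamma> \<in> ?P \<rightarrow>\<^sub>E UNIV. nodes \<gamma> * edges \<gamma>)"
    by (simp add: hwm_series_def nodes_def edges_def)
  \<comment> \<open>Labellings that are not lifts have a vanishing product over the
    hyperedges.\<close>
  also have "\<dots> = (\<Sum>\<gamma> \<in> lift ` (?D \<rightarrow>\<^sub>E UNIV). nodes \<gamma> * edges \<gamma>)"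
    using fin_P edges_0
    by (intro sum.mono_neutral_right) (auto simp: lift_def intro!: finite_PiE)
  also have "\<dots> = cut_sum ar mu lam t ?D"
    by (simp add: sum.reindex[OF inj] edges_lift nodes_lift cut_sum_def)
  finally show ?thesis .
qed

theorem proposition3:
  fixes \<Sigma> :: "'a set" and ar :: "'a \<Rightarrow> nat"
    and mu :: "'a \<Rightarrow> ('k::real_normed_field ^ 'd::finite) list \<Rightarrow> 'k ^ 'd"
    and lam :: "'k ^ 'd"
  assumes "ranked_alphabet \<Sigma> ar"
    and "tree_representation \<Sigma> ar mu"
    and "tree_over \<Sigma> ar t"
  shows "tree_series ar mu lam t =
    hwm_series (ext_arity ar) (tree_hwm mu lam) (tree_hypergraph t)"
proof -
  have "p \<in> dom t" if "p @ q \<in> dom t" for p q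
    using assms(3) that unfolding tree_over_def by blast
  then show ?thesis
    using cut_sum_eq_tree_series[OF assms(2,3) subset_refl tree_root_in_dom[OF assms(3)]]
      hwm_series_tree_hypergraph[OF assms(3)] by metis
qed

end
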